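(* Let $f_1,\dots,f_n:\mathbb{R}^d\to\mathbb{R}$ be convex, with each $f_i$ $L_i$-smooth ($L_i>0$), let $g:\mathbb{R}^d\to\mathbb{R}$ be $\mu$-strongly convex ($\mu>0$, possibly non-smooth), let $F=\frac1n\sum_{i=1}^n f_i+g$ and let $x^\star$ be the minimizer of $F$. Then, for a suitable choice of the parameters $\eta$, $\omega$, $m$ (with $0<\eta<1/\widetilde L$ and $0<\omega\le 1-\frac{\widetilde L\eta}{1-\widetilde L\eta}$), ASVRG for strongly convex objectives with Option II, restarted every $\mathcal S=2\left(\frac{1-\omega}{\omega}+\frac{\omega}{\eta m\mu}\right)$ epochs (see context), started at $\widetilde x^0$, finds an $\varepsilon$-suboptimal solution, i.e. an output $\widetilde x$ with $\mathbb{E}[F(\widetilde x)]-F(x^\star)\le\varepsilon$, with oracle complexity $$\mathcal{O}\left(\Big(n+\sqrt{n\widetilde L/\mu}\Big)\log\frac{F(\widetilde x^0)-F(x^\star)}{\varepsilon}\right).$$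
   Context: $L_i$-smooth means differentiable with $\|\nabla f_i(x)-\nabla f_i(y)\|\le L_i\|x-y\|$ for all $x,y$. $g$ is $\mu$-strongly convex if $g(y)\ge g(x)+\xi^T(y-x)+\frac{\mu}{2}\|x-y\|^2$ for all $x,y$ and $\xi\in\partial g(x)$. $P=(p_1,\dots,p_n)$ is a probability vector with all $p_i>0$, $f=\frac1n\sum_i f_i$, and $\widetilde L:=\max_j L_j/(np_j)$. ASVRG for strongly convex objectives, Option II, with step size $\eta>0$, momentum parameter $\omega$, epoch length $m\ge1$, started at $\widetilde x^0$: set $x_0^1=y_0^1=\widetilde x^0$. For $s=1,2,\dots$: compute $\nabla f(\widetilde x^{s-1})$; for $t=1,\dots,m$, draw $i_t\in\{1,\dots,n\}$ according to $P$, independently of everything before, and set $$\widetilde\nabla f_{i_t}(x^s_{t-1})=\frac{\nabla f_{i_t}(x^s_{t-1})-\nabla f_{i_t}(\widetilde x^{s-1})}{np_{i_t}}+\nabla f(\widetilde x^{s-1}),$$ $$y_t^s=\arg\min_{y\in\mathbb{R}^d}\Big\{\langle\widetilde\nabla f_{i_t}(x^s_{t-1}),y-y^s_{t-1}\rangle+\frac{\omega}{2\eta}\|y-y^s_{t-1}\|^2+g(y)\Big\},\qquad x_t^s=\widetilde x^{s-1}+\omega(y_t^s-\widetilde x^{s-1});$$ then set $\widetilde x^s=\frac1m\sum_{t=1}^m x_t^s$, $y_0^{s+1}=y_m^s$, $x_0^{s+1}=(1-\omega)\widetilde x^s+\omega y_m^s$. Restarts every $\mathcal S$ epochs ($\mathcal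 S$ rounded up to an integer): after $\mathcal S$ epochs the procedure is run anew from the new initial point $\frac1{\mathcal S}\sum_{s=1}^{\mathcal S}\widetilde x^s$ (used as the new $\widetilde x^0$); the output is the point obtained in this way after the last round. Oracle complexity is the total number of component gradient evaluations $\nabla f_i(\cdot)$ (a full gradient costs $n$, an inner iteration costs a constant number). The $\mathcal O$ hides only an absolute constant, and, as usual, $\varepsilon$ is taken small compared to the initial gap, e.g. $0<\varepsilon\le\frac12(F(\widetilde x^0)-F(x^\star))$. *)

theory Defs
  imports "HOL-Analysis.Analysis" "HOL-Probability.Probability_Mass_Function"
begin

definition grad :: "('a::euclidean_space \<Rightarrow> real) \<Rightarrow> 'a \<Rightarrow> 'a" where
  "grad h x = (THE D. GDERIV h x :> D)"

definition L_smooth :: "real \<Rightarrow> ('a::euclidean_space \<Rightarrow> real) \<Rightarrow> bool" where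
  "L_smooth L h \<longleftrightarrow>
     (\<forall>x. h differentiable (at x)) \<and>
     (\<forall>x y. norm (grad h x - grad h y) \<le> L * norm (x - y))"

definition subdifferential :: "('a::euclidean_space \<Rightarrow> real) \<Rightarrow> 'a \<Rightarrow> 'a set" where
  "subdifferential g x = {\<xi>. \<forall>y. g y \<ge> g x + \<xi> \<bullet> (y - x)}"

(* Convexity is stated separately: the subgradient inequality alone holds vacuously for
   functions that have no subgradients at all. *)
definition strongly_convex :: "real \<Rightarrow> ('a::euclidean_space \<Rightarrow> real) \<Rightarrow> bool" where
  "strongly_convex \<mu> g \<longleftrightarrow>
     convex_on UNIV g \<and>
     (\<forall>x y. \<forall>\<xi>\<in>subdifferential g x.
        g y \<ge> g x + \<xi> \<bullet> (y - x) + \<mu> / 2 * (norm (x - y))\<^sup>2)"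

definition average :: "nat \<Rightarrow> (nat \<Rightarrow> 'a::euclidean_space \<Rightarrow> real) \<Rightarrow> 'a \<Rightarrow> real" where
  "average n f x = (1 / real n) * (\<Sum>i=1..n. f i x)"

definition objective ::
  "nat \<Rightarrow> (nat \<Rightarrow> 'a::euclidean_space \<Rightarrow> real) \<Rightarrow> ('a \<Rightarrow> real) \<Rightarrow> 'a \<Rightarrow> real" where
  "objective n f g x = average n f x + g x"

definition L_tilde :: "nat \<Rightarrow> (nat \<Rightarrow> real) \<Rightarrow> nat pmf \<Rightarrow> real" where
  "L_tilde n L P = Max ((\<lambda>j. L j / (real n * pmf P j)) ` {1..n})"

definition svrg_gradient ::
  "nat \<Rightarrow> (nat \<Rightarrow> 'a::euclidean_space \<Rightarrow> real) \<Rightarrow> nat pmf \<Rightarrow> 'a \<Rightarrow> 'a \<Rightarrow> nat \<Rightarrow> 'a" where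
  "svrg_gradient n f P xt x i =
     (1 / (real n * pmf P i)) *\<^sub>R (grad (f i) x - grad (f i) xt) + grad (average n f) xt"

definition prox_step ::
  "('a::euclidean_space \<Rightarrow> real) \<Rightarrow> real \<Rightarrow> real \<Rightarrow> 'a \<Rightarrow> 'a \<Rightarrow> 'a" where
  "prox_step g \<eta> \<omega> v y0 =
     arg_min (\<lambda>y. v \<bullet> (y - y0) + \<omega> / (2 * \<eta>) * (norm (y - y0))\<^sup>2 + g y) (\<lambda>_. True)"

(* Law of (x_t, y_t, x_1 + ... + x_t) after t inner iterations with snapshot xt,
   started from (x_0, y_0) = (x0, y0). *)
primrec asvrg_inner ::
  "nat \<Rightarrow> (nat \<Rightarrow> 'a::euclidean_space \<Rightarrow> real) \<Rightarrow> ('a \<Rightarrow> real) \<Rightarrow> nat pmf \<Rightarrow> real \<Rightarrow> real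
     \<Rightarrow> 'a \<Rightarrow> 'a \<Rightarrow> 'a \<Rightarrow> nat \<Rightarrow> ('a \<times> 'a \<times> 'a) pmf" where
  "asvrg_inner n f g P \<eta> \<omega> xt x0 y0 0 = return_pmf (x0, y0, 0)"
| "asvrg_inner n f g P \<eta> \<omega> xt x0 y0 (Suc t) = do {
     (x, y, z) \<leftarrow> asvrg_inner n f g P \<eta> \<omega> xt x0 y0 t;
     i \<leftarrow> P;
     let y' = prox_step g \<eta> \<omega> (svrg_gradient n f P xt x i) y;
     let x' = xt + \<omega> *\<^sub>R (y' - xt);
     return_pmf (x', y', z + x')
   }"

(* Law, after s epochs started at xinit, of the latest snapshot, the starting points x_0 and
   y_0 of epoch s + 1, and the sum of the snapshots produced by epochs 1, ..., s. *)
primrec asvrg_epochs ::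
  "nat \<Rightarrow> (nat \<Rightarrow> 'a::euclidean_space \<Rightarrow> real) \<Rightarrow> ('a \<Rightarrow> real) \<Rightarrow> nat pmf \<Rightarrow> real \<Rightarrow> real \<Rightarrow> nat
     \<Rightarrow> 'a \<Rightarrow> nat \<Rightarrow> ('a \<times> 'a \<times> 'a \<times> 'a) pmf" where
  "asvrg_epochs n f g P \<eta> \<omega> m xinit 0 = return_pmf (xinit, xinit, xinit, 0)"
| "asvrg_epochs n f g P \<eta> \<omega> m xinit (Suc s) = do {
     (xt, x0, y0, w) \<leftarrow> asvrg_epochs n f g P \<eta> \<omega> m xinit s;
     (x, y, z) \<leftarrow> asvrg_inner n f g P \<eta> \<omega> xt x0 y0 m;
     let xt' = (1 / real m) *\<^sub>R z;
     return_pmf (xt', (1 - \<omega>) *\<^sub>R xt' + \<omega> *\<^sub>R y, y, w + xt')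
   }"

definition asvrg_round ::
  "nat \<Rightarrow> (nat \<Rightarrow> 'a::euclidean_space \<Rightarrow> real) \<Rightarrow> ('a \<Rightarrow> real) \<Rightarrow> nat pmf \<Rightarrow> real \<Rightarrow> real \<Rightarrow> nat
     \<Rightarrow> nat \<Rightarrow> 'a \<Rightarrow> 'a pmf" where
  "asvrg_round n f g P \<eta> \<omega> m S xinit = do {
     (xt, x0, y0, w) \<leftarrow> asvrg_epochs n f g P \<eta> \<omega> m xinit S;
     return_pmf ((1 / real S) *\<^sub>R w)
   }"

primrec asvrg_restarted ::
  "nat \<Rightarrow> (nat \<Rightarrow> 'a::euclidean_space \<Rightarrow> real) \<Rightarrow> ('a \<Rightarrow> real) \<Rightarrow> nat pmf \<Rightarrow> real \<Rightarrow> real \<Rightarrow> nat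
     \<Rightarrow> nat \<Rightarrow> 'a \<Rightarrow> nat \<Rightarrow> 'a pmf" where
  "asvrg_restarted n f g P \<eta> \<omega> m S xinit 0 = return_pmf xinit"
| "asvrg_restarted n f g P \<eta> \<omega> m S xinit (Suc r) = do {
     x \<leftarrow> asvrg_restarted n f g P \<eta> \<omega> m S xinit r;
     asvrg_round n f g P \<eta> \<omega> m S x
   }"

definition restart_length :: "real \<Rightarrow> real \<Rightarrow> nat \<Rightarrow> real \<Rightarrow> nat" where
  "restart_length \<eta> \<omega> m \<mu> = nat \<lceil>2 * ((1 - \<omega>) / \<omega> + \<omega> / (\<eta> * real m * \<mu>))\<rceil>"

(* Component gradient evaluations in R rounds of S epochs: an epoch computes one full gradient
   at the snapshot (n evaluations) and, in each of its m inner iterations, the gradient of the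
   drawn component at the current point and at the snapshot. *)
definition oracle_calls :: "nat \<Rightarrow> nat \<Rightarrow> nat \<Rightarrow> nat \<Rightarrow> nat" where
  "oracle_calls n m S R = R * (S * (n + m * 2))"

end

theory Submission
  imports Defs
begin

text \<open>One inner iteration satisfies, in expectation over the drawn index,
  \<open>E (\<Delta> x\<^sub>t + c \<parallel>y\<^sub>t - x*\<parallel>\<^sup>2) \<le> (1 - \<omega>) \<Delta> xt + c \<parallel>y\<^bsub>t-1\<^esub> - x*\<parallel>\<^sup>2\<close>, where \<open>\<Delta> = F - F x*\<close> and
  \<open>c = \<omega>\<^sup>2 / (2 \<eta>)\<close>: the upper bound on \<open>\<omega>\<close> makes the variance of the gradient estimator, which is at most
  \<open>2 Lt\<close> times the Bregman distance of the snapshot \<open>xt\<close>, fit into the term \<open>(1 - \<omega>) \<Delta> xt\<close>.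
  By Jensen's inequality this telescopes over the inner iterations and then over the epochs.
  Strong convexity bounds the remaining squared distance to \<open>x*\<close> by the initial gap, so a round of \<open>S\<close>
  epochs halves the expected gap, and logarithmically many rounds suffice.\<close>

section \<open>Smooth convex functions\<close>

lemma GDERIV_unique:
  assumes "GDERIV h x :> D" "GDERIV h x :> D'"
  shows "D = D'"
proof -
  have "(\<lambda>v. v \<bullet> D) = (\<lambda>v. v \<bullet> D')"
    using assms unfolding gderiv_def by (rule has_derivative_unique)
  then show ?thesis
    by (metis vector_eq_ldot)
qed

lemma grad_eq: "GDERIV h x :> D \<Longrightarrow> grad h x = D"
  unfolding grad_def by (blast intro: GDERIV_unique)

text \<open>\<open>grad\<close> is a definite description, so existence must be supplied: the
  derivative is a linear functional, and its Riesz representative is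
  \<open>adjoint h' 1\<close>.\<close>

lemma GDERIV_grad:
  fixes h :: "'a::euclidean_space \<Rightarrow> real"
  assumes "h differentiable (at x)"
  shows "GDERIV h x :> grad h x"
proof -
  obtain h' where h': "(h has_derivative h') (at x)"
    using assms unfolding differentiable_def by blast
  then have "linear h'"
    by (rule has_derivative_linear)
  then have "h' = (\<lambda>v. v \<bullet> adjoint h' 1)"
    by (simp add: fun_eq_iff adjoint_works)
  with h' have "GDERIV h x :> adjoint h' 1"
    unfolding gderiv_def by simp
  then show ?thesis
    using grad_eq by metis
qed

lemma GDERIV_line:
  fixes h :: "'a::real_inner \<Rightarrow> real"
  assumes "GDERIV h (x + t *\<^sub>R v) :> D"
  shows "((\<lambda>t. h (x + t *\<^sub>R v)) has_real_derivative D \<bullet> v) (at t)"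
proof -
  have "((\<lambda>t. x + t *\<^sub>R v) has_derivative (\<lambda>s. s *\<^sub>R v)) (at t)"
    by (auto intro!: derivative_eq_intros)
  moreover have "(h has_derivative (\<lambda>w. w \<bullet> D)) (at (x + t *\<^sub>R v))"
    using assms unfolding gderiv_def .
  ultimately have "((\<lambda>t. h (x + t *\<^sub>R v)) has_derivative (\<lambda>s. (s *\<^sub>R v) \<bullet> D)) (at t)"
    by (rule has_derivative_compose)
  then show ?thesis
    by (simp add: has_field_derivative_def inner_commute mult.commute[of _ "_ \<bullet> _"])
qed

text \<open>The limit is one-sided because convexity controls the quotient only for small positive
  \<open>t\<close>. It serves both the gradient inequality and the optimality condition at
  \<open>xstar\<close>.\<close>

lemma GDERIV_quotient_tendsto:
  fixes h :: "'a::real_inner \<Rightarrow> real"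
  assumes "GDERIV h x :> D"
  shows "((\<lambda>t. (h (x + t *\<^sub>R v) - h x) / t) \<longlongrightarrow> D \<bullet> v) (at_right 0)"
proof -
  have "((\<lambda>t. h (x + t *\<^sub>R v)) has_real_derivative D \<bullet> v) (at 0)"
    using assms by (intro GDERIV_line) simp
  then have "((\<lambda>t. (h (x + t *\<^sub>R v) - h x) / t) \<longlongrightarrow> D \<bullet> v) (at 0)"
    by (simp add: has_field_derivative_iff)
  then show ?thesis
    by (rule filterlim_mono) (simp_all add: at_le)
qed

lemma convex_on_quotient_le:
  fixes h :: "'a::real_vector \<Rightarrow> real"
  assumes "convex_on UNIV h" "0 < t" "t < 1"
  shows "(h (x + t *\<^sub>R (y - x)) - h x) / t \<le> h y - h x"
proof -
  have "h ((1 - t) *\<^sub>R x + t *\<^sub>R y) \<le> (1 - t) * h x + t * h y"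
    using assms by (intro convex_onD) auto
  moreover have "(1 - t) *\<^sub>R x + t *\<^sub>R y = x + t *\<^sub>R (y - x)"
    by (simp add: algebra_simps)
  ultimately show ?thesis
    using assms(2) by (simp add: field_simps)
qed

lemma eventually_at_right_unit: "eventually (\<lambda>t::real. 0 < t \<and> t < 1) (at_right 0)"
  by (auto simp: eventually_at_right_field intro!: exI[of _ 1])

lemma convex_gradient_ineq:
  fixes h :: "'a::real_inner \<Rightarrow> real"
  assumes "convex_on UNIV h" "GDERIV h x :> D"
  shows "h x + D \<bullet> (y - x) \<le> h y"
proof -
  have "eventually (\<lambda>t. (h (x + t *\<^sub>R (y - x)) - h x) / t \<le> h y - h x) (at_right 0)"
    using eventually_at_right_unit
    by eventually_elim (simp add: convex_on_quotient_le[OF assms(1)])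
  then have "D \<bullet> (y - x) \<le> h y - h x"
    using GDERIV_quotient_tendsto[OF assms(2)] by (intro tendsto_upperbound) auto
  then show ?thesis
    by simp
qed

text \<open>Jensen's inequality as a recursion, scaled by the number of points so that it
  telescopes. With \<open>z = 0\<close> at \<open>t = 0\<close>, the value \<open>1 / 0 = 0\<close>
  does no harm. It is applied to the inner iterates and again to the snapshots.\<close>

lemma convex_running_mean:
  fixes h :: "'a::real_vector \<Rightarrow> real"
  assumes "convex_on UNIV h" "t = 0 \<Longrightarrow> z = 0"
  shows "real (Suc t) * h ((1 / real (Suc t)) *\<^sub>R (z + x)) \<le> real t * h ((1 / real t) *\<^sub>R z) + h x"
proof (cases "t = 0")
  case False
  define \<alpha> where "\<alpha> = 1 / real (Suc t)"
  have \<alpha>: "0 \<le> \<alpha>" "\<alpha> \<le> 1" "real (Suc t) * \<alpha> = 1" "real (Suc t) * (1 - \<alpha>) = real t"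
    "(1 - \<alpha>) * (1 / real t) = \<alpha>"
    using False by (auto simp: \<alpha>_def field_simps)
  have "\<alpha> *\<^sub>R (z + x) = (1 - \<alpha>) *\<^sub>R ((1 / real t) *\<^sub>R z) + \<alpha> *\<^sub>R x"
    unfolding scaleR_scaleR \<alpha>(5) by (rule scaleR_add_right)
  then have "h (\<alpha> *\<^sub>R (z + x)) \<le> (1 - \<alpha>) * h ((1 / real t) *\<^sub>R z) + \<alpha> * h x"
    using convex_onD[OF assms(1) \<alpha>(1,2), of "(1 / real t) *\<^sub>R z" x] by (simp only: UNIV_I simp_thms)
  then have "real (Suc t) * h (\<alpha> *\<^sub>R (z + x)) \<le>
      real (Suc t) * ((1 - \<alpha>) * h ((1 / real t) *\<^sub>R z) + \<alpha> * h x)"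
    by (intro mult_left_mono) auto
  also have "\<dots> = real t * h ((1 / real t) *\<^sub>R z) + h x"
    unfolding distrib_left mult.assoc[symmetric] \<alpha> by simp
  finally show ?thesis
    unfolding \<alpha>_def .
qed (use assms in simp)

text \<open>Along the segment, \<open>h\<close> minus its quadratic model has nonpositive
  derivative, by Cauchy-Schwarz and the Lipschitz bound on the gradient.\<close>

lemma descent_lemma:
  fixes h :: "'a::euclidean_space \<Rightarrow> real"
  assumes "L_smooth L h"
  shows "h y \<le> h x + grad h x \<bullet> (y - x) + L / 2 * (norm (y - x))\<^sup>2"
proof -
  define v where "v = y - x"
  define \<phi> where "\<phi> t = h (x + t *\<^sub>R v) - t * (grad h x \<bullet> v) - L / 2 * t\<^sup>2 * (norm v)\<^sup>2" for t
  have "\<phi> 1 \<le> \<phi> 0"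
  proof (rule DERIV_nonpos_imp_nonincreasing[of 0 1])
    fix t :: real assume t: "0 \<le> t" "t \<le> 1"
    let ?D = "(grad h (x + t *\<^sub>R v) - grad h x) \<bullet> v - L * t * (norm v)\<^sup>2"
    have "((\<lambda>t. h (x + t *\<^sub>R v)) has_real_derivative grad h (x + t *\<^sub>R v) \<bullet> v) (at t)"
      using assms unfolding L_smooth_def by (intro GDERIV_line GDERIV_grad) auto
    then have D: "(\<phi> has_real_derivative ?D) (at t)"
      unfolding \<phi>_def by (auto intro!: derivative_eq_intros simp: inner_diff_left)
    have "norm (grad h (x + t *\<^sub>R v) - grad h x) \<le> L * norm (x + t *\<^sub>R v - x)"
      using assms unfolding L_smooth_def by blast
    then have "norm (grad h (x + t *\<^sub>R v) - grad h x) * norm v \<le> L * t * (norm v)\<^sup>2"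
      using t mult_right_mono[of _ _ "norm v"] by (fastforce simp: power2_eq_square)
    with norm_cauchy_schwarz[of "grad h (x + t *\<^sub>R v) - grad h x" v]
    have "?D \<le> 0"
      by linarith
    then show "\<exists>y. (\<phi> has_real_derivative y) (at t) \<and> y \<le> 0"
      using D by blast
  qed simp
  then show ?thesis
    unfolding \<phi>_def v_def by simp
qed

text \<open>Convexity at \<open>x\<close> bounds \<open>h z\<close> from below and smoothness at
  \<open>y\<close> bounds it from above. The right-hand side is the Bregman distance of
  \<open>y\<close> from \<open>x\<close>, the form that the variance bound needs.\<close>

lemma gradient_cocoercive:
  fixes h :: "'a::euclidean_space \<Rightarrow> real"
  assumes "convex_on UNIV h" "L_smooth L h" "L > 0"
  shows "(norm (grad h x - grad h y))\<^sup>2 \<le> 2 * L * (h y - h x - grad h x \<bullet> (y - x))"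
proof -
  define w where "w = grad h y - grad h x"
  \<comment> \<open>The minimizer of the quadratic upper model at \<open>y\<close>, after
    subtracting the linear function with slope \<open>grad h x\<close>.\<close>
  define z where "z = y - (1 / L) *\<^sub>R w"
  have D: "GDERIV h x :> grad h x"
    using assms(2) unfolding L_smooth_def by (intro GDERIV_grad) auto
  have "h x + grad h x \<bullet> (z - x) \<le> h z"
    using assms(1) D by (rule convex_gradient_ineq)
  also have "\<dots> \<le> h y + grad h y \<bullet> (z - y) + L / 2 * (norm (z - y))\<^sup>2"
    using assms(2) by (rule descent_lemma)
  also have "L / 2 * (norm (z - y))\<^sup>2 = (w \<bullet> w) / (2 * L)"
    using assms(3) by (simp add: z_def power2_norm_eq_inner[symmetric] field_simps power2_eq_square)
  also have "grad h y \<bullet> (z - y) = - (grad h x \<bullet> w) / L - (w \<bullet> w) / L"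
    using assms(3) by (simp add: z_def w_def inner_diff_left inner_diff_right field_simps)
  also have "grad h x \<bullet> (z - x) = grad h x \<bullet> (y - x) - (grad h x \<bullet> w) / L"
    by (simp add: z_def inner_diff_right)
  finally have "h x + grad h x \<bullet> (y - x) + ((w \<bullet> w) / L - (w \<bullet> w) / (2 * L)) \<le> h y"
    by simp
  then have "w \<bullet> w \<le> 2 * L * (h y - h x - grad h x \<bullet> (y - x))"
    using assms(3) by (simp add: field_simps)
  then show ?thesis
    by (simp add: w_def norm_minus_commute[of "grad h x"] power2_norm_eq_inner)
qed

section \<open>The proximal step\<close>

lemma norm_convex_combination:
  fixes a b :: "'a::real_inner"
  shows "(norm ((1 - t) *\<^sub>R a + t *\<^sub>R b))\<^sup>2 =
    (1 - t) * (norm a)\<^sup>2 + t * (norm b)\<^sup>2 - t * (1 - t) * (norm (b - a))\<^sup>2"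
  unfolding power2_norm_eq_inner
  by (simp add: inner_add_left inner_add_right inner_diff_left inner_diff_right inner_commute
      algebra_simps power2_eq_square)

text \<open>\<open>prox_step\<close> is an \<open>arg_min\<close>, which carries information only if
  the minimum is attained. The affine minorant given by \<open>\<xi>\<close> makes the objective
  coercive, so minimizing over a compact ball suffices.\<close>

lemma prox_minimizer_exists:
  fixes g :: "'a::euclidean_space \<Rightarrow> real"
  assumes "convex_on UNIV g" "\<xi> \<in> subdifferential g x" "a > 0"
  shows "\<exists>p. \<forall>y. v \<bullet> (p - y0) + a * (norm (p - y0))\<^sup>2 + g p \<le> v \<bullet> (y - y0) + a * (norm (y - y0))\<^sup>2 + g y"
proof -
  define h where "h y = v \<bullet> (y - y0) + a * (norm (y - y0))\<^sup>2 + g y" for y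
  define B where "B = norm v + norm \<xi>"
  define C where "C = g y0 - g x - \<xi> \<bullet> (y0 - x)"
  \<comment> \<open>Beyond this radius \<open>a * q\<close> is at least \<open>B + C\<close>: the
    quadratic term beats the slope \<open>B\<close> of the linear terms and the deficit
    \<open>C\<close> of the minorant at \<open>y0\<close>. The summand 1 ensures
    \<open>q \<ge> 1\<close>.\<close>
  define r where "r = (B + C) / a + 1"
  have minorant: "g x + \<xi> \<bullet> (y - x) \<le> g y" for y
    using assms(2) unfolding subdifferential_def by auto
  have B: "B \<ge> 0" and C: "C \<ge> 0"
    using minorant[of y0] unfolding B_def C_def by auto
  then have r: "r \<ge> 1"
    using assms(3) unfolding r_def by simp
  have "continuous_on UNIV g"
    using assms(1) by (intro convex_on_continuous) auto
  then have "continuous_on (cball y0 r) h"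
    unfolding h_def by (intro continuous_intros) (auto intro: continuous_on_subset)
  then obtain p where p: "p \<in> cball y0 r" "\<And>y. y \<in> cball y0 r \<Longrightarrow> h p \<le> h y"
    using r continuous_attains_inf[of "cball y0 r" h] by auto
  have "h p \<le> h y" for y
  proof (cases "y \<in> cball y0 r")
    case False
    define q where "q = norm (y - y0)"
    have q: "q \<ge> r"
      using False by (simp add: q_def dist_norm norm_minus_commute)
    have "a * q \<ge> a * r"
      using q assms(3) by simp
    moreover have "a * r = B + C + a"
      using assms(3) unfolding r_def by (simp only: distrib_left) simp
    ultimately have "a * q - B \<ge> C"
      using assms(3) by simp
    moreover have "q \<ge> 1"
      using q r by simp
    ultimately have "C * 1 \<le> (a * q - B) * q"
      using C by (intro mult_mono) auto
    moreover have "- (norm v * q) \<le> v \<bullet> (y - y0)" "- (norm \<xi> * q) \<le> \<xi> \<bullet> (y - y0)"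
      using Cauchy_Schwarz_ineq2[of v "y - y0"] Cauchy_Schwarz_ineq2[of \<xi> "y - y0"]
      unfolding q_def by linarith+
    moreover have "\<xi> \<bullet> (y - x) = \<xi> \<bullet> (y - y0) + \<xi> \<bullet> (y0 - x)"
      by (simp add: inner_diff_right)
    ultimately have "g y0 \<le> h y"
      using minorant[of y] unfolding h_def C_def B_def q_def[symmetric]
      by (simp add: algebra_simps power2_eq_square)
    moreover have "h p \<le> h y0"
      using p(2) r by simp
    ultimately show ?thesis
      by (simp add: h_def)
  qed (use p in auto)
  then show ?thesis
    unfolding h_def by blast
qed

text \<open>The quadratic term makes the proximal objective strongly convex, so its minimum
  undercuts the value at \<open>u\<close> by a multiple of the squared distance to
  \<open>u\<close>.\<close>

lemma prox_step_three_point: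
  fixes g :: "'a::euclidean_space \<Rightarrow> real"
  assumes "convex_on UNIV g" "\<xi> \<in> subdifferential g x" "\<eta> > 0" "\<omega> > 0"
  shows "v \<bullet> (prox_step g \<eta> \<omega> v y0 - y0) + \<omega> / (2 * \<eta>) * (norm (prox_step g \<eta> \<omega> v y0 - y0))\<^sup>2
      + g (prox_step g \<eta> \<omega> v y0) + \<omega> / (2 * \<eta>) * (norm (prox_step g \<eta> \<omega> v y0 - u))\<^sup>2
    \<le> v \<bullet> (u - y0) + \<omega> / (2 * \<eta>) * (norm (u - y0))\<^sup>2 + g u"
proof -
  define a where "a = \<omega> / (2 * \<eta>)"
  have a: "a > 0"
    using assms(3,4) by (simp add: a_def)
  define h where "h y = v \<bullet> (y - y0) + a * (norm (y - y0))\<^sup>2 + g y" for y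
  define p where "p = prox_step g \<eta> \<omega> v y0"
  obtain q where q: "\<And>y. h q \<le> h y"
    using prox_minimizer_exists[OF assms(1,2) a, of v y0] unfolding h_def by blast
  have "p = arg_min h (\<lambda>_. True)"
    unfolding p_def prox_step_def h_def a_def ..
  then have min: "h p \<le> h y" for y
    using arg_minI[of "\<lambda>_. True" q h "\<lambda>p. \<forall>y. h p \<le> h y"] q by (simp add: not_less)
  \<comment> \<open>Minimality of \<open>p\<close> against a point of the segment towards
    \<open>u\<close>, divided by \<open>t\<close>; the factor \<open>1 - t\<close> disappears in the
    limit \<open>t\<close> to 0.\<close>
  have "h p + a * (1 - t) * (norm (u - p))\<^sup>2 \<le> h u" if t: "0 < t" "t < 1" for t
  proof -
    define z where "z = (1 - t) *\<^sub>R p + t *\<^sub>R u"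
    have z: "z - y0 = (1 - t) *\<^sub>R (p - y0) + t *\<^sub>R (u - y0)"
      by (simp add: z_def algebra_simps)
    have lin: "v \<bullet> (z - y0) = (1 - t) * (v \<bullet> (p - y0)) + t * (v \<bullet> (u - y0))"
      by (simp add: z inner_add_right)
    have quad: "(norm (z - y0))\<^sup>2 =
        (1 - t) * (norm (p - y0))\<^sup>2 + t * (norm (u - y0))\<^sup>2 - t * (1 - t) * (norm (u - p))\<^sup>2"
      using norm_convex_combination[of t "p - y0" "u - y0"] by (simp add: z)
    have "g z \<le> (1 - t) * g p + t * g u"
      unfolding z_def using assms(1) t by (intro convex_onD) auto
    then have "h z \<le> (1 - t) * h p + t * h u - a * (t * (1 - t) * (norm (u - p))\<^sup>2)"
      unfolding h_def lin quad by (simp add: algebra_simps)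
    with min[of z] have "t * (h p + a * (1 - t) * (norm (u - p))\<^sup>2) \<le> t * h u"
      by (simp add: algebra_simps)
    then show ?thesis
      using t by simp
  qed
  then have "eventually (\<lambda>t. h p + a * (1 - t) * (norm (u - p))\<^sup>2 \<le> h u) (at_right 0)"
    by (auto intro!: eventually_mono[OF eventually_at_right_unit])
  moreover have "((\<lambda>t. h p + a * (1 - t) * (norm (u - p))\<^sup>2) \<longlongrightarrow> h p + a * (1 - 0) * (norm (u - p))\<^sup>2) (at_right 0)"
    by (intro tendsto_intros)
  ultimately have "h p + a * (1 - 0) * (norm (u - p))\<^sup>2 \<le> h u"
    by (intro tendsto_upperbound) auto
  then show ?thesis
    unfolding h_def p_def a_def by (simp add: norm_minus_commute)
qed

section \<open>Finitely supported expectations\<close>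

text \<open>The laws of the method have finite support because \<open>P\<close> does, so
  integrability is automatic throughout.\<close>

lemma expectation_bind_finite:
  fixes h :: "'b \<Rightarrow> real"
  assumes "finite (set_pmf p)" "\<And>x. x \<in> set_pmf p \<Longrightarrow> finite (set_pmf (q x))"
  shows "measure_pmf.expectation (p \<bind> q) h =
    measure_pmf.expectation p (\<lambda>x. measure_pmf.expectation (q x) h)"
  by (simp add: pmf_expectation_bind[of "set_pmf p"] integral_measure_pmf[of "set_pmf p"] assms)

lemma expectation_mono_finite:
  fixes h k :: "'b \<Rightarrow> real"
  assumes "finite (set_pmf p)" "\<And>x. x \<in> set_pmf p \<Longrightarrow> h x \<le> k x"
  shows "measure_pmf.expectation p h \<le> measure_pmf.expectation p k"
  using assms by (intro integral_mono_AE integrable_measure_pmf_finite) (auto simp: AE_measure_pmf_iff)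

section \<open>The composite problem and the variance of the gradient estimator\<close>

locale composite_problem =
  fixes n :: nat
    and f :: "nat \<Rightarrow> 'a::euclidean_space \<Rightarrow> real"
    and g :: "'a \<Rightarrow> real"
    and L :: "nat \<Rightarrow> real"
    and \<mu> :: real
    and P :: "nat pmf"
    and xstar :: 'a
  assumes n_ge: "n \<ge> 1"
    and set_P: "set_pmf P = {1..n}"
    and convex_f: "\<And>i. i \<in> {1..n} \<Longrightarrow> convex_on UNIV (f i)"
    and L_pos: "\<And>i. i \<in> {1..n} \<Longrightarrow> L i > 0"
    and smooth_f: "\<And>i. i \<in> {1..n} \<Longrightarrow> L_smooth (L i) (f i)"
    and mu_pos: "\<mu> > 0"
    and strongly_convex_g: "strongly_convex \<mu> g"
    and xstar_min: "is_arg_min (objective n f g) (\<lambda>_. True) xstar"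
begin

abbreviation "Lt \<equiv> L_tilde n L P"
abbreviation "favg \<equiv> average n f"

definition "gap x = objective n f g x - objective n f g xstar"

lemma gap_nonneg: "gap x \<ge> 0"
  using xstar_min by (simp add: gap_def is_arg_min_linorder)

lemma convex_g: "convex_on UNIV g"
  using strongly_convex_g by (simp add: strongly_convex_def)

lemma pmf_P_pos: "i \<in> {1..n} \<Longrightarrow> pmf P i > 0"
  using set_P by (simp add: pmf_positive_iff)

lemma sum_pmf_P: "(\<Sum>i=1..n. pmf P i) = 1"
  using set_P by (intro sum_pmf_eq_1) auto

lemma expectation_P: "measure_pmf.expectation P h = (\<Sum>i=1..n. pmf P i * h i)" for h :: "nat \<Rightarrow> real"
  using set_P by (subst integral_measure_pmf[of "{1..n}"]) auto

lemma L_le: "i \<in> {1..n} \<Longrightarrow> L i / (real n * pmf P i) \<le> Lt"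
  unfolding L_tilde_def by (intro Max_ge) auto

lemma Lt_pos: "Lt > 0"
proof -
  have 1: "1 \<in> {1..n}"
    using n_ge by simp
  then have "0 < L 1 / (real n * pmf P 1)"
    using n_ge by (intro divide_pos_pos mult_pos_pos L_pos pmf_P_pos) auto
  also have "\<dots> \<le> Lt"
    using 1 by (rule L_le)
  finally show ?thesis .
qed

text \<open>Each \<open>L i\<close> is at most \<open>Lt * n * pmf P i\<close>, and the
  probabilities sum to 1. Hence \<open>Lt\<close> serves as the smoothness constant of the average
  as well as in the variance bound.\<close>

lemma mean_L_le: "(1 / real n) * (\<Sum>i=1..n. L i) \<le> Lt"
proof -
  have "(\<Sum>i=1..n. L i) \<le> (\<Sum>i=1..n. Lt * real n * pmf P i)"
  proof (rule sum_mono)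
    fix i assume "i \<in> {1..n}"
    then show "L i \<le> Lt * real n * pmf P i"
      using L_le[of i] pmf_P_pos[of i] n_ge by (simp add: field_simps)
  qed
  also have "\<dots> = Lt * real n"
    using sum_pmf_P by (simp flip: sum_distrib_left)
  finally show ?thesis
    using n_ge by (simp add: field_simps)
qed

lemma GDERIV_f: "i \<in> {1..n} \<Longrightarrow> GDERIV (f i) x :> grad (f i) x"
  using smooth_f by (intro GDERIV_grad) (auto simp: L_smooth_def)

lemma grad_favg: "grad favg x = (1 / real n) *\<^sub>R (\<Sum>i=1..n. grad (f i) x)"
  and GDERIV_favg: "GDERIV favg x :> grad favg x"
proof -
  have "GDERIV favg x :> (1 / real n) *\<^sub>R (\<Sum>i=1..n. grad (f i) x)"
    using GDERIV_f n_ge unfolding gderiv_def average_def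
    by (auto intro!: derivative_eq_intros simp: inner_sum_right)
  then show "grad favg x = (1 / real n) *\<^sub>R (\<Sum>i=1..n. grad (f i) x)"
    and "GDERIV favg x :> grad favg x"
    using grad_eq by metis+
qed

lemma convex_favg: "convex_on UNIV favg"
proof -
  have "convex_on UNIV (\<lambda>x. \<Sum>i\<in>I. f i x)" if "finite I" "I \<subseteq> {1..n}" for I
    using that by (induction I) (auto simp: convex_on_const intro!: convex_on_add convex_f)
  from this[of "{1..n}"] show ?thesis
    unfolding average_def by (intro convex_on_cmul) auto
qed

lemma convex_objective: "convex_on UNIV (objective n f g)"
  unfolding objective_def by (intro convex_on_add convex_favg convex_g)

lemma convex_gap: "convex_on UNIV gap"
  using convex_on_add[OF convex_objective, of "\<lambda>_. - objective n f g xstar"]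
  by (simp add: gap_def[abs_def] convex_on_const)

lemma favg_gradient_ineq: "favg x + grad favg x \<bullet> (y - x) \<le> favg y"
  using convex_favg GDERIV_favg by (rule convex_gradient_ineq)

lemma favg_descent: "favg y \<le> favg x + grad favg x \<bullet> (y - x) + Lt / 2 * (norm (y - x))\<^sup>2"
proof -
  have "(\<Sum>i=1..n. f i y) \<le> (\<Sum>i=1..n. f i x + grad (f i) x \<bullet> (y - x) + L i / 2 * (norm (y - x))\<^sup>2)"
    using smooth_f by (intro sum_mono descent_lemma)
  also have "\<dots> = (\<Sum>i=1..n. f i x) + (\<Sum>i=1..n. grad (f i) x) \<bullet> (y - x)
      + (\<Sum>i=1..n. L i) / 2 * (norm (y - x))\<^sup>2"
    by (simp add: sum.distrib inner_sum_left sum_distrib_right sum_divide_distrib)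
  finally have "favg y \<le> (1 / real n) * \<dots>"
    unfolding average_def by (intro mult_left_mono) auto
  also have "\<dots> = favg x + grad favg x \<bullet> (y - x)
      + ((1 / real n) * (\<Sum>i=1..n. L i)) / 2 * (norm (y - x))\<^sup>2"
    by (simp add: average_def grad_favg algebra_simps)
  also have "\<dots> \<le> favg x + grad favg x \<bullet> (y - x) + Lt / 2 * (norm (y - x))\<^sup>2"
    using mean_L_le by (intro add_left_mono mult_right_mono divide_right_mono) auto
  finally show ?thesis .
qed

text \<open>Besides optimality, this yields the affine minorant of \<open>g\<close> that makes the proximal subproblems
  coercive, and the one subgradient at which the definition of strong convexity has to be applied.\<close>

lemma xstar_subgradient: "- grad favg xstar \<in> subdifferential g xstar"
proof -
  have "g xstar + (- grad favg xstar) \<bullet> (y - xstar) \<le> g y" for y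
  proof -
    \<comment> \<open>The total difference quotient at \<open>xstar\<close> is nonnegative and
      convexity bounds that of \<open>g\<close> from above, so only the smooth part is
      differentiated in the limit.\<close>
    have "eventually (\<lambda>t. - (g y - g xstar) \<le> (favg (xstar + t *\<^sub>R (y - xstar)) - favg xstar) / t) (at_right 0)"
      using eventually_at_right_unit
    proof eventually_elim
      case (elim t)
      let ?z = "xstar + t *\<^sub>R (y - xstar)"
      have "0 \<le> gap ?z / t"
        using gap_nonneg elim by simp
      also have "\<dots> = (favg ?z - favg xstar) / t + (g ?z - g xstar) / t"
        by (simp add: gap_def objective_def diff_divide_distrib add_divide_distrib)
      finally show ?case
        using convex_on_quotient_le[OF convex_g, of t xstar y] elim by linarith
    qed
    then have "- (g y - g xstar) \<le> grad favg xstar \<bullet> (y - xstar)"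
      using GDERIV_quotient_tendsto[OF GDERIV_favg] by (intro tendsto_lowerbound) auto
    then show ?thesis
      by simp
  qed
  then show ?thesis
    unfolding subdifferential_def by blast
qed

text \<open>Strong convexity of \<open>g\<close> and the gradient inequality of \<open>favg\<close>
  are added; the linear terms cancel because the subgradient is
  \<open>- grad favg xstar\<close>.\<close>

lemma gap_quadratic_growth: "\<mu> / 2 * (norm (x - xstar))\<^sup>2 \<le> gap x"
proof -
  have "g xstar + (- grad favg xstar) \<bullet> (x - xstar) + \<mu> / 2 * (norm (xstar - x))\<^sup>2 \<le> g x"
    using strongly_convex_g xstar_subgradient unfolding strongly_convex_def by blast
  moreover have "favg xstar + grad favg xstar \<bullet> (x - xstar) \<le> favg x"
    by (rule favg_gradient_ineq)
  ultimately show ?thesis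
    by (simp add: gap_def objective_def norm_minus_commute)
qed

lemma svrg_gradient_unbiased: "(\<Sum>i=1..n. pmf P i *\<^sub>R svrg_gradient n f P xt x i) = grad favg x"
proof -
  have "(\<Sum>i=1..n. pmf P i *\<^sub>R svrg_gradient n f P xt x i)
      = (\<Sum>i=1..n. (1 / real n) *\<^sub>R (grad (f i) x - grad (f i) xt) + pmf P i *\<^sub>R grad favg xt)"
    using pmf_P_pos
    by (intro sum.cong) (force simp: svrg_gradient_def scaleR_add_right)+
  also have "\<dots> = (1 / real n) *\<^sub>R ((\<Sum>i=1..n. grad (f i) x) - (\<Sum>i=1..n. grad (f i) xt)) + grad favg xt"
    using sum_pmf_P by (simp add: sum.distrib sum_subtractf flip: scaleR_sum_right scaleR_sum_left)
  also have "\<dots> = grad favg x"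
    by (simp add: grad_favg scaleR_diff_right)
  finally show ?thesis .
qed

text \<open>The variance is at most the second moment of the weighted gradient differences.
  Cocoercivity bounds each of these by a Bregman distance, with \<open>L i / (n * pmf P i)\<close>
  absorbed by \<open>Lt\<close>. Keeping the linear term of that distance is what permits the
  cancellation in \<open>step_expectation\<close>.\<close>

lemma svrg_gradient_variance:
  "(\<Sum>i=1..n. pmf P i * (norm (grad favg x - svrg_gradient n f P xt x i))\<^sup>2)
    \<le> 2 * Lt * (favg xt - favg x - grad favg x \<bullet> (xt - x))"
proof -
  define w where "w i = (1 / (real n * pmf P i)) *\<^sub>R (grad (f i) x - grad (f i) xt)" for i
  define e where "e = grad favg x - grad favg xt"
  have v: "svrg_gradient n f P xt x i = w i + grad favg xt" for i
    by (simp add: svrg_gradient_def w_def)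
  have mean_w: "(\<Sum>i=1..n. pmf P i *\<^sub>R w i) = e"
    using svrg_gradient_unbiased[of xt x] sum_pmf_P
    by (simp add: v e_def scaleR_add_right sum.distrib algebra_simps flip: scaleR_sum_left)
  have "(\<Sum>i=1..n. pmf P i * (norm (grad favg x - svrg_gradient n f P xt x i))\<^sup>2)
      = (\<Sum>i=1..n. pmf P i * (norm (w i))\<^sup>2 - 2 * ((pmf P i *\<^sub>R w i) \<bullet> e) + pmf P i * (norm e)\<^sup>2)"
  proof (intro sum.cong refl)
    fix i
    have *: "grad favg x - svrg_gradient n f P xt x i = e - w i"
      by (simp add: v e_def)
    show "pmf P i * (norm (grad favg x - svrg_gradient n f P xt x i))\<^sup>2 =
        pmf P i * (norm (w i))\<^sup>2 - 2 * ((pmf P i *\<^sub>R w i) \<bullet> e) + pmf P i * (norm e)\<^sup>2"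
      unfolding * power2_norm_eq_inner
      by (simp add: inner_diff_left inner_diff_right inner_commute algebra_simps)
  qed
  also have "\<dots> = (\<Sum>i=1..n. pmf P i * (norm (w i))\<^sup>2) - 2 * (e \<bullet> e) + (norm e)\<^sup>2"
    unfolding sum.distrib sum_subtractf
    by (simp only: sum_pmf_P mean_w mult_1 flip: sum_distrib_left sum_distrib_right inner_sum_left)
  also have "\<dots> \<le> (\<Sum>i=1..n. pmf P i * (norm (w i))\<^sup>2)"
    by (simp add: power2_norm_eq_inner)
  also have "\<dots> \<le> (\<Sum>i=1..n. (2 * Lt / real n) * (f i xt - f i x - grad (f i) x \<bullet> (xt - x)))"
  proof (rule sum_mono)
    fix i assume i: "i \<in> {1..n}"
    define D where "D = f i xt - f i x - grad (f i) x \<bullet> (xt - x)"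
    have p: "pmf P i > 0" and n: "real n > 0"
      using pmf_P_pos[OF i] n_ge by auto
    have D: "D \<ge> 0"
      using convex_gradient_ineq[OF convex_f GDERIV_f, OF i i, of x xt] by (simp add: D_def)
    have "pmf P i * (norm (w i))\<^sup>2 = (norm (grad (f i) x - grad (f i) xt))\<^sup>2 / ((real n)\<^sup>2 * pmf P i)"
      using p n by (simp add: w_def power_mult_distrib power_divide power2_eq_square)
    also have "\<dots> \<le> (2 * L i * D) / ((real n)\<^sup>2 * pmf P i)"
      using gradient_cocoercive[OF convex_f smooth_f L_pos, OF i i i, of x xt] p
      by (intro divide_right_mono) (auto simp: D_def)
    also have "\<dots> = (2 / real n) * (L i / (real n * pmf P i)) * D"
      by (simp add: power2_eq_square)
    also have "\<dots> \<le> (2 / real n) * Lt * D"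
      using L_le[OF i] D by (intro mult_right_mono mult_left_mono) auto
    finally show "pmf P i * (norm (w i))\<^sup>2 \<le> (2 * Lt / real n) * D"
      by (simp add: mult.commute)
  qed
  also have "\<dots> = 2 * Lt * (favg xt - favg x - grad favg x \<bullet> (xt - x))"
    unfolding sum_distrib_left[symmetric] sum_subtractf
    by (simp add: average_def grad_favg inner_sum_left diff_divide_distrib right_diff_distrib)
  finally show ?thesis .
qed

end

section \<open>Convergence of the restarted method\<close>

locale asvrg = composite_problem n f g L \<mu> P xstar
  for n f and g :: "'a::euclidean_space \<Rightarrow> real" and L \<mu> P xstar +
  fixes \<eta> \<omega> :: real
  assumes eta_pos: "0 < \<eta>"
    and eta_less: "\<eta> < 1 / Lt"
    and omega_pos: "0 < \<omega>"
    and omega_le: "\<omega> \<le> 1 - Lt * \<eta> / (1 - Lt * \<eta>)"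
begin

text \<open>The proximal weight \<open>\<omega> / (2 * \<eta>)\<close> times the weight
  \<open>\<omega>\<close> of \<open>y'\<close> in the new iterate.\<close>

definition "c = \<omega>\<^sup>2 / (2 * \<eta>)"

lemma c_nonneg: "c \<ge> 0"
  using eta_pos by (simp add: c_def)

lemma Lt_eta: "Lt * \<eta> < 1"
  using eta_less Lt_pos by (simp add: field_simps)

lemma omega_le_1: "\<omega> \<le> 1"
proof -
  have "Lt * \<eta> / (1 - Lt * \<eta>) \<ge> 0"
    using Lt_eta Lt_pos eta_pos by simp
  then show ?thesis
    using omega_le by simp
qed

text \<open>For an arbitrary direction \<open>v\<close>: smoothness of \<open>favg\<close> between
  \<open>x\<close> and \<open>x'\<close>, convexity of \<open>g\<close> at \<open>x'\<close>, and
  \<open>\<omega>\<close> times the three-point inequality at \<open>xstar\<close> are added. The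
  error of \<open>v\<close> survives only as a squared norm and in the term linear in
  \<open>v\<close>.\<close>

lemma step_pointwise:
  fixes v xt y :: 'a
  defines "x \<equiv> xt + \<omega> *\<^sub>R (y - xt)"
  defines "y' \<equiv> prox_step g \<eta> \<omega> v y"
  defines "x' \<equiv> xt + \<omega> *\<^sub>R (y' - xt)"
  shows "objective n f g x' + c * (norm (y' - xstar))\<^sup>2 \<le>
    favg x + \<omega> * (v \<bullet> (xstar - y)) + c * (norm (y - xstar))\<^sup>2 + \<omega> * g xstar + (1 - \<omega>) * g xt
    + \<eta> / (2 * (1 - Lt * \<eta>)) * (norm (grad favg x - v))\<^sup>2"
proof -
  define d where "d = \<omega> *\<^sub>R (y' - y)"
  define e where "e = grad favg x - v"
  \<comment> \<open>The Young parameter for which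
    \<open>Lt / 2 + \<beta> / 2 = 1 / (2 * \<eta>)\<close>: the two quadratic terms in
    \<open>d\<close> add up to exactly the proximal term, which then cancels.\<close>
  define \<beta> where "\<beta> = 1 / \<eta> - Lt"
  have \<beta>: "\<beta> > 0"
    using Lt_eta eta_pos by (simp add: \<beta>_def field_simps)
  have x': "x' - x = d"
    by (simp add: x'_def x_def d_def algebra_simps)
  have norm_d: "(norm d)\<^sup>2 = \<omega>\<^sup>2 * (norm (y' - y))\<^sup>2"
    by (simp add: d_def power_mult_distrib)
  have f: "favg x' \<le> favg x + grad favg x \<bullet> d + Lt / 2 * (norm d)\<^sup>2"
    using favg_descent[of x' x] by (simp add: x')
  have "0 \<le> (norm (e - \<beta> *\<^sub>R d))\<^sup>2 / (2 * \<beta>)"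
    using \<beta> by simp
  also have "\<dots> = 1 / (2 * \<beta>) * (norm e)\<^sup>2 + \<beta> / 2 * (norm d)\<^sup>2 - e \<bullet> d"
    using \<beta> unfolding power2_norm_eq_inner
    by (simp add: inner_diff_left inner_diff_right inner_commute field_simps)
  finally have young: "e \<bullet> d \<le> 1 / (2 * \<beta>) * (norm e)\<^sup>2 + \<beta> / 2 * (norm d)\<^sup>2"
    by simp
  have "Lt / 2 * (norm d)\<^sup>2 + \<beta> / 2 * (norm d)\<^sup>2 = c * (norm (y' - y))\<^sup>2"
    by (simp add: \<beta>_def norm_d c_def left_diff_distrib diff_divide_distrib)
  moreover have "grad favg x \<bullet> d = \<omega> * (v \<bullet> (y' - y)) + e \<bullet> d"
    by (simp add: e_def d_def inner_diff_left right_diff_distrib)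
  moreover have "1 / (2 * \<beta>) = \<eta> / (2 * (1 - Lt * \<eta>))"
    using eta_pos Lt_eta by (simp add: \<beta>_def field_simps)
  ultimately have 1: "favg x' \<le> favg x + \<omega> * (v \<bullet> (y' - y)) + c * (norm (y' - y))\<^sup>2
      + \<eta> / (2 * (1 - Lt * \<eta>)) * (norm e)\<^sup>2"
    using f young by simp
  have "x' = (1 - \<omega>) *\<^sub>R xt + \<omega> *\<^sub>R y'"
    by (simp add: x'_def algebra_simps)
  then have 2: "g x' \<le> (1 - \<omega>) * g xt + \<omega> * g y'"
    using convex_onD[OF convex_g _ omega_le_1] omega_pos by simp
  have "\<omega> * (v \<bullet> (y' - y) + \<omega> / (2 * \<eta>) * (norm (y' - y))\<^sup>2 + g y' + \<omega> / (2 * \<eta>) * (norm (y' - xstar))\<^sup>2)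
      \<le> \<omega> * (v \<bullet> (xstar - y) + \<omega> / (2 * \<eta>) * (norm (xstar - y))\<^sup>2 + g xstar)"
    unfolding y'_def using omega_pos eta_pos
    by (intro mult_left_mono prox_step_three_point[OF convex_g xstar_subgradient]) auto
  moreover have "\<omega> * (\<omega> / (2 * \<eta>) * r) = c * r" for r
    by (simp add: c_def power2_eq_square)
  ultimately have 3: "\<omega> * (v \<bullet> (y' - y)) + c * (norm (y' - y))\<^sup>2 + \<omega> * g y' + c * (norm (y' - xstar))\<^sup>2
      \<le> \<omega> * (v \<bullet> (xstar - y)) + c * (norm (y - xstar))\<^sup>2 + \<omega> * g xstar"
    by (simp only: distrib_left norm_minus_commute[of xstar y])
  show ?thesis
    using 1 2 3 unfolding objective_def e_def by linarith
qed

lemma step_expectation: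
  fixes xt y :: 'a
  defines "x \<equiv> xt + \<omega> *\<^sub>R (y - xt)"
  defines "y' \<equiv> \<lambda>i. prox_step g \<eta> \<omega> (svrg_gradient n f P xt x i) y"
  defines "x' \<equiv> \<lambda>i. xt + \<omega> *\<^sub>R (y' i - xt)"
  shows "measure_pmf.expectation P (\<lambda>i. gap (x' i) + c * (norm (y' i - xstar))\<^sup>2)
    \<le> (1 - \<omega>) * gap xt + c * (norm (y - xstar))\<^sup>2"
proof -
  define v where "v i = svrg_gradient n f P xt x i" for i
  define q where "q = \<eta> / (2 * (1 - Lt * \<eta>))"
  define D where "D = favg xt - favg x - grad favg x \<bullet> (xt - x)"
  define K where "K = favg x + c * (norm (y - xstar))\<^sup>2 + \<omega> * g xstar + (1 - \<omega>) * g xt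
    - objective n f g xstar"
  have D: "D \<ge> 0"
    using favg_gradient_ineq[of x xt] by (simp add: D_def)
  have "measure_pmf.expectation P (\<lambda>i. gap (x' i) + c * (norm (y' i - xstar))\<^sup>2)
      \<le> (\<Sum>i=1..n. pmf P i * (K + \<omega> * (v i \<bullet> (xstar - y)) + q * (norm (grad favg x - v i))\<^sup>2))"
    unfolding expectation_P
  proof (intro sum_mono mult_left_mono)
    fix i
    show "gap (x' i) + c * (norm (y' i - xstar))\<^sup>2
        \<le> K + \<omega> * (v i \<bullet> (xstar - y)) + q * (norm (grad favg x - v i))\<^sup>2"
      using step_pointwise[of xt "v i" y] unfolding gap_def K_def q_def x'_def y'_def x_def v_def
      by linarith
  qed simp
  also have "\<dots> = K * (\<Sum>i=1..n. pmf P i) + \<omega> * ((\<Sum>i=1..n. pmf P i *\<^sub>R v i) \<bullet> (xstar - y))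
      + q * (\<Sum>i=1..n. pmf P i * (norm (grad favg x - v i))\<^sup>2)"
    by (simp add: sum.distrib distrib_left sum_distrib_left inner_sum_left mult_ac)
  also have "\<dots> = K + \<omega> * (grad favg x \<bullet> (xstar - y)) + q * (\<Sum>i=1..n. pmf P i * (norm (grad favg x - v i))\<^sup>2)"
    unfolding sum_pmf_P v_def svrg_gradient_unbiased by simp
  also have "q * (\<Sum>i=1..n. pmf P i * (norm (grad favg x - v i))\<^sup>2) \<le> q * (2 * Lt * D)"
    unfolding v_def D_def using eta_pos Lt_eta
    by (intro mult_left_mono svrg_gradient_variance) (simp add: q_def)
  also have "q * (2 * Lt * D) = (Lt * \<eta> / (1 - Lt * \<eta>)) * D"
    using Lt_eta by (simp add: q_def divide_simps)
  \<comment> \<open>The upper bound on \<open>\<omega>\<close> enters here: the variance is charged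
    to the weight of the snapshot.\<close>
  also have "\<dots> \<le> (1 - \<omega>) * D"
    using omega_le D by (intro mult_right_mono) auto
  finally have *: "measure_pmf.expectation P (\<lambda>i. gap (x' i) + c * (norm (y' i - xstar))\<^sup>2)
      \<le> K + \<omega> * (grad favg x \<bullet> (xstar - y)) + (1 - \<omega>) * D"
    by simp
  have "\<omega> * (favg x + grad favg x \<bullet> (xstar - x)) \<le> \<omega> * favg xstar"
    using omega_pos by (intro mult_left_mono favg_gradient_ineq) simp
  \<comment> \<open>Because \<open>x\<close> is the convex combination of \<open>xt\<close> and
    \<open>y\<close>, the linear part of \<open>D\<close> turns the direction towards
    \<open>xstar\<close> from \<open>y\<close> into the one from \<open>x\<close>, where the
    gradient inequality applies.\<close>
  moreover have "\<omega> * (grad favg x \<bullet> (xstar - y)) - (1 - \<omega>) * (grad favg x \<bullet> (xt - x))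
      = \<omega> * (grad favg x \<bullet> (xstar - x))"
  proof -
    have "\<omega> *\<^sub>R (xstar - y) - (1 - \<omega>) *\<^sub>R (xt - x) = \<omega> *\<^sub>R (xstar - x)"
      by (simp add: x_def algebra_simps)
    then show ?thesis
      by (metis inner_diff_right inner_scaleR_right)
  qed
  ultimately have "K + \<omega> * (grad favg x \<bullet> (xstar - y)) + (1 - \<omega>) * D
      \<le> (1 - \<omega>) * gap xt + c * (norm (y - xstar))\<^sup>2"
    by (simp add: K_def D_def gap_def objective_def algebra_simps)
  with * show ?thesis
    by simp
qed

section \<open>Telescoping over the inner iterations of an epoch\<close>

lemma finite_set_inner: "finite (set_pmf (asvrg_inner n f g P \<eta> \<omega> xt x0 y0 t))"
  by (induction t) (auto simp: set_P Let_def split: prod.split)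

text \<open>The one-step bound presupposes that \<open>x\<close> is the combination of snapshot and
  \<open>y\<close>, and the running mean presupposes the empty sum at \<open>t = 0\<close>.\<close>

lemma inner_invariant:
  assumes "x0 = xt + \<omega> *\<^sub>R (y0 - xt)" "(x, y, z) \<in> set_pmf (asvrg_inner n f g P \<eta> \<omega> xt x0 y0 t)"
  shows "x = xt + \<omega> *\<^sub>R (y - xt) \<and> (t = 0 \<longrightarrow> z = 0)"
  using assms(2) by (cases t) (auto simp: assms(1) Let_def split: prod.splits)

text \<open>For \<open>t = 0\<close> the running mean \<open>(1 / t) z\<close> is the junk value \<open>0\<close>, which the factor \<open>t\<close> cancels.\<close>

lemma inner_potential:
  assumes x0: "x0 = xt + \<omega> *\<^sub>R (y0 - xt)"
  shows "measure_pmf.expectation (asvrg_inner n f g P \<eta> \<omega> xt x0 y0 t)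
      (\<lambda>(x, y, z). real t * gap ((1 / real t) *\<^sub>R z) + c * (norm (y - xstar))\<^sup>2)
    \<le> real t * (1 - \<omega>) * gap xt + c * (norm (y0 - xstar))\<^sup>2"
proof (induction t)
  case (Suc t)
  let ?M = "asvrg_inner n f g P \<eta> \<omega> xt x0 y0 t"
  let ?h = "\<lambda>(x, y, z). real (Suc t) * gap ((1 / real (Suc t)) *\<^sub>R z) + c * (norm (y - xstar))\<^sup>2"
  let ?k = "\<lambda>(x, y, z). real t * gap ((1 / real t) *\<^sub>R z) + c * (norm (y - xstar))\<^sup>2"
  let ?y = "\<lambda>x y i. prox_step g \<eta> \<omega> (svrg_gradient n f P xt x i) y"
  let ?x = "\<lambda>x y i. xt + \<omega> *\<^sub>R (?y x y i - xt)"
  let ?q = "\<lambda>(x, y, z). P \<bind> (\<lambda>i. return_pmf (?x x y i, ?y x y i, z + ?x x y i))"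
  have fin: "finite (set_pmf (?q s))" for s
    by (simp add: set_P split: prod.split)
  have "measure_pmf.expectation (?M \<bind> ?q) ?h
      = measure_pmf.expectation ?M (\<lambda>s. measure_pmf.expectation (?q s) ?h)"
    by (rule expectation_bind_finite[OF finite_set_inner fin])
  also have "\<dots> \<le> measure_pmf.expectation ?M (\<lambda>s. ?k s + (1 - \<omega>) * gap xt)"
  proof (rule expectation_mono_finite[OF finite_set_inner])
    fix s assume s: "s \<in> set_pmf ?M"
    obtain x y z where [simp]: "s = (x, y, z)"
      by (cases s)
    have inv: "x = xt + \<omega> *\<^sub>R (y - xt)" "t = 0 \<Longrightarrow> z = 0"
      using inner_invariant[OF x0] s by auto
    have "measure_pmf.expectation (?q s) ?h
        = measure_pmf.expectation P (\<lambda>i. ?h (?x x y i, ?y x y i, z + ?x x y i))"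
      by (simp add: expectation_bind_finite set_P)
    also have "\<dots> \<le> measure_pmf.expectation P
        (\<lambda>i. real t * gap ((1 / real t) *\<^sub>R z) + (gap (?x x y i) + c * (norm (?y x y i - xstar))\<^sup>2))"
      unfolding case_prod_conv add.assoc[of _ _ "c * _", symmetric] using set_P inv(2)
      by (intro expectation_mono_finite add_right_mono convex_running_mean[OF convex_gap]) auto
    also have "\<dots> = real t * gap ((1 / real t) *\<^sub>R z) +
        measure_pmf.expectation P (\<lambda>i. gap (?x x y i) + c * (norm (?y x y i - xstar))\<^sup>2)"
      using set_P
      by (subst Bochner_Integration.integral_add) (auto intro!: integrable_measure_pmf_finite)
    also have "\<dots> \<le> ?k s + (1 - \<omega>) * gap xt"
      using step_expectation[of xt y] by (simp add: inv(1)[symmetric])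
    finally show "measure_pmf.expectation (?q s) ?h \<le> ?k s + (1 - \<omega>) * gap xt" .
  qed
  also have "\<dots> = measure_pmf.expectation ?M ?k + (1 - \<omega>) * gap xt"
    by (subst Bochner_Integration.integral_add) (auto intro!: integrable_measure_pmf_finite finite_set_inner)
  also have "\<dots> \<le> real (Suc t) * (1 - \<omega>) * gap xt + c * (norm (y0 - xstar))\<^sup>2"
    using Suc.IH by (simp add: algebra_simps)
  finally show ?case
    by (simp add: Let_def)
qed simp

section \<open>Telescoping over epochs\<close>

lemma finite_set_epochs: "finite (set_pmf (asvrg_epochs n f g P \<eta> \<omega> m xinit s))"
  by (induction s) (auto simp: finite_set_inner Let_def split: prod.split)

text \<open>The prescribed starting point \<open>x0\<close> of each epoch is the combination with
  the new snapshot that \<open>inner_potential\<close> requires.\<close>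

lemma epochs_invariant:
  assumes "(xt, x0, y0, w) \<in> set_pmf (asvrg_epochs n f g P \<eta> \<omega> m xinit s)"
  shows "x0 = xt + \<omega> *\<^sub>R (y0 - xt) \<and> (s = 0 \<longrightarrow> w = 0)"
  using assms by (cases s) (auto simp: Let_def algebra_simps split: prod.splits)

text \<open>After division by \<open>m\<close>, the gap of the new snapshot is split: the share
  \<open>\<omega>\<close> joins the accumulated mean, and \<open>1 - \<omega>\<close> pays for the
  variance of the next epoch. The distance term carries over because the next epoch starts from the
  last \<open>y\<close>.\<close>

lemma epochs_potential:
  assumes m: "m \<ge> 1"
  shows "measure_pmf.expectation (asvrg_epochs n f g P \<eta> \<omega> m xinit s)
      (\<lambda>(xt, x0, y0, w). \<omega> * (real s * gap ((1 / real s) *\<^sub>R w)) + (1 - \<omega>) * gap xt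
        + c / real m * (norm (y0 - xstar))\<^sup>2)
    \<le> (1 - \<omega>) * gap xinit + c / real m * (norm (xinit - xstar))\<^sup>2"
proof (induction s)
  case (Suc s)
  let ?M = "asvrg_epochs n f g P \<eta> \<omega> m xinit s"
  let ?h = "\<lambda>s (xt, x0, y0, w). \<omega> * (real s * gap ((1 / real s) *\<^sub>R w)) + (1 - \<omega>) * gap xt
        + c / real m * (norm (y0 - xstar))\<^sup>2"
  let ?N = "\<lambda>(xt, x0, y0, w). asvrg_inner n f g P \<eta> \<omega> xt x0 y0 m"
  let ?r = "\<lambda>w (x, y, z). ((1 / real m) *\<^sub>R z, (1 - \<omega>) *\<^sub>R ((1 / real m) *\<^sub>R z) + \<omega> *\<^sub>R y, y,
      w + (1 / real m) *\<^sub>R z)"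
  let ?q = "\<lambda>(xt, x0, y0, w). asvrg_inner n f g P \<eta> \<omega> xt x0 y0 m \<bind> (\<lambda>u. return_pmf (?r w u))"
  let ?k = "\<lambda>(x, y, z). real m * gap ((1 / real m) *\<^sub>R z) + c * (norm (y - xstar))\<^sup>2"
  have fin: "finite (set_pmf (?q u))" for u
    by (simp add: finite_set_inner split: prod.split)
  have "measure_pmf.expectation (?M \<bind> ?q) (?h (Suc s))
      = measure_pmf.expectation ?M (\<lambda>u. measure_pmf.expectation (?q u) (?h (Suc s)))"
    by (rule expectation_bind_finite[OF finite_set_epochs fin])
  also have "\<dots> \<le> measure_pmf.expectation ?M (?h s)"
  proof (rule expectation_mono_finite[OF finite_set_epochs])
    fix u assume u: "u \<in> set_pmf ?M"
    obtain xt x0 y0 w where [simp]: "u = (xt, x0, y0, w)"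
      by (cases u)
    have inv: "x0 = xt + \<omega> *\<^sub>R (y0 - xt)" "s = 0 \<Longrightarrow> w = 0"
      using epochs_invariant u by auto
    let ?A = "\<omega> * (real s * gap ((1 / real s) *\<^sub>R w))"
    have "measure_pmf.expectation (?q u) (?h (Suc s))
        = measure_pmf.expectation (?N u) (\<lambda>v. ?h (Suc s) (?r w v))"
      by (simp add: expectation_bind_finite finite_set_inner)
    also have "\<dots> \<le> measure_pmf.expectation (?N u) (\<lambda>v. ?A + (1 / real m) * ?k v)"
    proof (rule expectation_mono_finite)
      fix v :: "'a \<times> 'a \<times> 'a"
      obtain x y z where v: "v = (x, y, z)"
        by (cases v)
      let ?x = "(1 / real m) *\<^sub>R z"
      have "\<omega> * (real (Suc s) * gap ((1 / real (Suc s)) *\<^sub>R (w + ?x)))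
          \<le> \<omega> * (real s * gap ((1 / real s) *\<^sub>R w) + gap ?x)"
        using omega_pos inv(2) by (intro mult_left_mono convex_running_mean convex_gap) auto
      moreover have "(1 / real m) * ?k v = gap ?x + c / real m * (norm (y - xstar))\<^sup>2"
        using m by (simp add: v field_simps)
      ultimately show "?h (Suc s) (?r w v) \<le> ?A + (1 / real m) * ?k v"
        by (simp add: v algebra_simps)
    qed (simp add: finite_set_inner)
    also have "\<dots> = ?A + (1 / real m) * measure_pmf.expectation (?N u) ?k"
      by (subst Bochner_Integration.integral_add)
        (auto intro!: integrable_measure_pmf_finite finite_set_inner)
    also have "\<dots> \<le> ?A + (1 / real m) * (real m * (1 - \<omega>) * gap xt + c * (norm (y0 - xstar))\<^sup>2)"
      using inner_potential[OF inv(1), of m] by (intro add_left_mono mult_left_mono) auto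
    also have "\<dots> = ?h s u"
      using m by (simp add: field_simps)
    finally show "measure_pmf.expectation (?q u) (?h (Suc s)) \<le> ?h s u" .
  qed
  also note Suc.IH
  finally show ?case
    by (simp add: Let_def case_prod_unfold)
qed simp

section \<open>Rounds and restarts\<close>

lemma finite_set_round: "finite (set_pmf (asvrg_round n f g P \<eta> \<omega> m S xinit))"
  by (auto simp: asvrg_round_def finite_set_epochs split: prod.split)

text \<open>The final snapshot and distance terms of the potential are nonnegative and are dropped;
  quadratic growth turns the initial distance into the initial gap.\<close>

lemma round_gap:
  assumes m: "m \<ge> 1"
  shows "\<omega> * real S * measure_pmf.expectation (asvrg_round n f g P \<eta> \<omega> m S xinit) gap
    \<le> ((1 - \<omega>) + \<omega>\<^sup>2 / (\<eta> * real m * \<mu>)) * gap xinit"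
proof -
  let ?M = "asvrg_epochs n f g P \<eta> \<omega> m xinit S"
  have "measure_pmf.expectation (asvrg_round n f g P \<eta> \<omega> m S xinit) gap
      = measure_pmf.expectation ?M (\<lambda>(xt, x0, y0, w). gap ((1 / real S) *\<^sub>R w))"
    unfolding asvrg_round_def
    by (subst expectation_bind_finite) (auto simp: finite_set_epochs case_prod_unfold)
  then have "\<omega> * real S * measure_pmf.expectation (asvrg_round n f g P \<eta> \<omega> m S xinit) gap
      = measure_pmf.expectation ?M (\<lambda>u. \<omega> * real S * (case u of (xt, x0, y0, w) \<Rightarrow> gap ((1 / real S) *\<^sub>R w)))"
    by simp
  also have "\<dots> \<le> measure_pmf.expectation ?M
      (\<lambda>(xt, x0, y0, w). \<omega> * (real S * gap ((1 / real S) *\<^sub>R w)) + (1 - \<omega>) * gap xt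
        + c / real m * (norm (y0 - xstar))\<^sup>2)"
    using omega_le_1 gap_nonneg c_nonneg
    by (intro expectation_mono_finite finite_set_epochs) (auto split: prod.split intro!: add_nonneg_nonneg)
  also have "\<dots> \<le> (1 - \<omega>) * gap xinit + c / real m * (norm (xinit - xstar))\<^sup>2"
    using m by (rule epochs_potential)
  also have "c / real m * (norm (xinit - xstar))\<^sup>2 \<le> c / real m * (2 / \<mu> * gap xinit)"
    using gap_quadratic_growth[of xinit] mu_pos c_nonneg
    by (intro mult_left_mono) (auto simp: field_simps)
  also have "c / real m * (2 / \<mu> * gap xinit) = \<omega>\<^sup>2 / (\<eta> * real m * \<mu>) * gap xinit"
    by (simp add: c_def)
  finally show ?thesis
    by (simp add: distrib_right)
qed

lemma restart_length_pos:
  assumes "m \<ge> 1"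
  shows "restart_length \<eta> \<omega> m \<mu> > 0"
proof -
  have "0 < (1 - \<omega>) / \<omega> + \<omega> / (\<eta> * real m * \<mu>)"
    using assms omega_pos omega_le_1 eta_pos mu_pos by (intro add_nonneg_pos) auto
  then show ?thesis
    unfolding restart_length_def by (simp only: zero_less_nat_eq zero_less_ceiling zero_less_mult_iff) simp
qed

text \<open>The factor in \<open>round_gap\<close> is \<open>\<omega> * r\<close>, where
  \<open>2 * r\<close> is the restart length before rounding up.\<close>

lemma round_halves_gap:
  assumes m: "m \<ge> 1"
  defines "S \<equiv> restart_length \<eta> \<omega> m \<mu>"
  shows "measure_pmf.expectation (asvrg_round n f g P \<eta> \<omega> m S xinit) gap \<le> gap xinit / 2"
proof -
  define r where "r = (1 - \<omega>) / \<omega> + \<omega> / (\<eta> * real m * \<mu>)"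
  let ?E = "measure_pmf.expectation (asvrg_round n f g P \<eta> \<omega> m S xinit) gap"
  have r: "2 * r \<le> real S"
    unfolding S_def restart_length_def r_def by linarith
  have S: "real S > 0"
    using restart_length_pos[OF m] by (simp add: S_def)
  have "(1 - \<omega>) + \<omega>\<^sup>2 / (\<eta> * real m * \<mu>) = \<omega> * r"
    using omega_pos by (simp add: r_def distrib_left power2_eq_square)
  then have "\<omega> * (real S * ?E) \<le> \<omega> * (r * gap xinit)"
    using round_gap[OF m, of S xinit] by (simp add: mult.assoc)
  then have "real S * ?E \<le> r * gap xinit"
    using omega_pos by simp
  also have "\<dots> \<le> real S / 2 * gap xinit"
    using r gap_nonneg by (intro mult_right_mono) auto
  finally have "real S * ?E \<le> real S * (gap xinit / 2)"
    by simp
  then show ?thesis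
    using S by simp
qed

lemma finite_set_restarted: "finite (set_pmf (asvrg_restarted n f g P \<eta> \<omega> m S xinit R))"
  by (induction R) (auto simp: finite_set_round)

text \<open>Halving holds for every starting point, so it can be applied conditionally on the
  outcome of the previous rounds.\<close>

lemma restarted_gap:
  assumes m: "m \<ge> 1"
  defines "S \<equiv> restart_length \<eta> \<omega> m \<mu>"
  shows "measure_pmf.expectation (asvrg_restarted n f g P \<eta> \<omega> m S xinit R) gap \<le> gap xinit / 2 ^ R"
proof (induction R)
  case (Suc R)
  let ?M = "asvrg_restarted n f g P \<eta> \<omega> m S xinit R"
  have "measure_pmf.expectation (asvrg_restarted n f g P \<eta> \<omega> m S xinit (Suc R)) gap
      = measure_pmf.expectation ?M (\<lambda>x. measure_pmf.expectation (asvrg_round n f g P \<eta> \<omega> m S x) gap)"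
    by (simp add: expectation_bind_finite finite_set_restarted finite_set_round)
  also have "\<dots> \<le> measure_pmf.expectation ?M (\<lambda>x. gap x / 2)"
    unfolding S_def
    by (intro expectation_mono_finite finite_set_restarted round_halves_gap[OF m])
  also have "\<dots> \<le> gap xinit / 2 ^ Suc R"
    using Suc.IH by simp
  finally show ?case .
qed simp

lemma restarted_objective:
  assumes "m \<ge> 1"
  shows "measure_pmf.expectation (asvrg_restarted n f g P \<eta> \<omega> m (restart_length \<eta> \<omega> m \<mu>) xinit R)
      (objective n f g) - objective n f g xstar \<le> gap xinit / 2 ^ R"
proof -
  let ?M = "asvrg_restarted n f g P \<eta> \<omega> m (restart_length \<eta> \<omega> m \<mu>) xinit R"
  have "measure_pmf.expectation ?M gap = measure_pmf.expectation ?M (objective n f g) - objective n f g xstar"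
    unfolding gap_def[abs_def]
    by (subst Bochner_Integration.integral_diff)
      (auto intro!: integrable_measure_pmf_finite finite_set_restarted)
  then show ?thesis
    using restarted_gap[OF assms] by metis
qed

end

section \<open>Choice of the parameters\<close>

text \<open>With \<open>m = n\<close> and \<open>\<eta> = 1 / (4 Lt)\<close> the number of epochs per round is about
  \<open>2 / \<omega> + 8 \<omega> \<kappa> / n\<close>, where \<open>\<kappa> = Lt / \<mu>\<close>; the minimizer of this bound is
  \<open>\<omega> = n / (2 sqrt (n \<kappa>))\<close>, which is truncated at the largest admissible momentum \<open>2 / 3\<close>.\<close>

lemma momentum_choice:
  fixes Lt \<mu> :: real
  assumes n: "n \<ge> 1" and Lt: "Lt > 0" and \<mu>: "\<mu> > 0"
  defines "s \<equiv> sqrt (real n * Lt / \<mu>)"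
  shows "\<exists>\<omega>. 0 < \<omega> \<and> \<omega> \<le> 2 / 3 \<and>
    3 * real n * real (restart_length (1 / (4 * Lt)) \<omega> n \<mu>) \<le> 24 * (real n + s)"
proof -
  have n0: "real n > 0" and s0: "s > 0"
    using assms by auto
  have s2: "s\<^sup>2 = real n * Lt / \<mu>"
    using assms by simp
  \<comment> \<open>Since \<open>2 * (1 - \<omega>) / \<omega> = 2 / \<omega> - 2\<close> and
    rounding up costs at most 1, a surplus of 1 remains.\<close>
  have S: "real (restart_length (1 / (4 * Lt)) \<omega> n \<mu>) \<le> 2 / \<omega> + 8 * \<omega> * s\<^sup>2 / (real n)\<^sup>2 - 1"
    if \<omega>: "0 < \<omega>" "\<omega> \<le> 2 / 3" for \<omega>
  proof -
    define r where "r = 2 * ((1 - \<omega>) / \<omega> + \<omega> / (1 / (4 * Lt) * real n * \<mu>))"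
    have "r = 2 / \<omega> + 8 * \<omega> * s\<^sup>2 / (real n)\<^sup>2 - 2"
      using n0 \<omega> \<mu> Lt unfolding r_def s2 by (simp add: field_simps power2_eq_square)
    moreover have "r \<ge> 0"
      using n0 \<omega> \<mu> Lt unfolding r_def by simp
    moreover have "restart_length (1 / (4 * Lt)) \<omega> n \<mu> = nat \<lceil>r\<rceil>"
      unfolding restart_length_def r_def ..
    ultimately show ?thesis
      by linarith
  qed
  show ?thesis
  \<comment> \<open>The case condition says exactly that
    \<open>n / (2 * s) \<le> 2 / 3\<close>.\<close>
  proof (cases "3 * real n \<le> 4 * s")
    case True
    let ?\<omega> = "real n / (2 * s)"
    have \<omega>: "0 < ?\<omega>" "?\<omega> \<le> 2 / 3"
      using True n0 s0 by (auto simp: field_simps)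
    \<comment> \<open>At this momentum the two terms are balanced, each equal to
      \<open>4 * s / n\<close>.\<close>
    have "2 / ?\<omega> + 8 * ?\<omega> * s\<^sup>2 / (real n)\<^sup>2 - 1 = 8 * s / real n - 1"
      using n0 s0 by (simp add: field_simps power2_eq_square)
    then have "3 * real n * real (restart_length (1 / (4 * Lt)) ?\<omega> n \<mu>) \<le> 3 * real n * (8 * s / real n - 1)"
      using S[OF \<omega>] by (intro mult_left_mono) auto
    also have "\<dots> \<le> 24 * (real n + s)"
      using n0 by (simp add: field_simps)
    finally show ?thesis
      using \<omega> by blast
  next
    case False
    \<comment> \<open>Here the condition number is small against \<open>n\<close>, so a bounded
      number of epochs per round suffices.\<close>
    have "s\<^sup>2 \<le> (3 / 4 * real n)\<^sup>2"
      using False s0 by (intro power_mono) auto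
    then have ratio: "s\<^sup>2 / (real n)\<^sup>2 \<le> 9 / 16"
      using n0 by (simp add: field_simps power2_eq_square)
    have "real (restart_length (1 / (4 * Lt)) (2 / 3) n \<mu>)
        \<le> 2 / (2 / 3) + 8 * (2 / 3) * s\<^sup>2 / (real n)\<^sup>2 - 1"
      by (rule S) auto
    also have "\<dots> = 2 + 16 / 3 * (s\<^sup>2 / (real n)\<^sup>2)"
      by simp
    also have "\<dots> \<le> 5"
      using ratio by linarith
    finally have "real (restart_length (1 / (4 * Lt)) (2 / 3) n \<mu>) \<le> 5" .
    then have "3 * real n * real (restart_length (1 / (4 * Lt)) (2 / 3) n \<mu>) \<le> 3 * real n * 5"
      using n0 by (intro mult_left_mono) auto
    also have "\<dots> \<le> 24 * (real n + s)"
      using n0 s0 by simp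
    finally show ?thesis
      by (intro exI[of _ "2 / 3"]) simp
  qed
qed

text \<open>\<open>r\<close> will be the initial gap divided by the accuracy. With
  \<open>log 2 r \<ge> 1\<close>, rounding up at most doubles the logarithm, and
  \<open>2 / ln 2 \<le> 3\<close>.\<close>

lemma halving_rounds:
  fixes r :: real
  assumes "r \<ge> 2"
  shows "\<exists>R::nat. r \<le> 2 ^ R \<and> real R \<le> 3 * ln r"
proof -
  define R where "R = nat \<lceil>log 2 r\<rceil>"
  have log: "log 2 r \<ge> 1"
    using assms by simp
  then have "log 2 r \<le> real R"
    unfolding R_def by linarith
  then have "r \<le> 2 powr real R"
    using assms by (simp add: log_le_iff)
  then have "r \<le> 2 ^ R"
    by (simp add: powr_realpow)
  moreover have "real R \<le> 2 * log 2 r"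
    using log unfolding R_def by linarith
  moreover have "2 * log 2 r \<le> 3 * ln r"
  proof -
    have "2 * ln r \<le> (3 * ln 2) * ln r"
      using ln2_ge_two_thirds assms by (intro mult_right_mono) auto
    then show ?thesis
      by (simp add: log_def field_simps)
  qed
  ultimately show ?thesis
    by (intro exI[of _ R]) simp
qed

text \<open>The parameters are fixed before the starting point and the accuracy, on which only the
  number \<open>R\<close> of rounds depends; 100 is the absolute constant of the complexity
  bound.\<close>

theorem corollary5:
  fixes n :: nat
    and f :: "nat \<Rightarrow> 'a::euclidean_space \<Rightarrow> real"
    and g :: "'a \<Rightarrow> real"
    and L :: "nat \<Rightarrow> real"
    and \<mu> :: real
    and P :: "nat pmf"
    and xstar :: 'a
  assumes "n \<ge> 1"
    and "set_pmf P = {1..n}"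
    and "\<And>i. i \<in> {1..n} \<Longrightarrow> convex_on UNIV (f i)"
    and "\<And>i. i \<in> {1..n} \<Longrightarrow> L i > 0"
    and "\<And>i. i \<in> {1..n} \<Longrightarrow> L_smooth (L i) (f i)"
    and "\<mu> > 0"
    and "strongly_convex \<mu> g"
    and "is_arg_min (objective n f g) (\<lambda>_. True) xstar"
  shows "\<exists>\<eta> \<omega> m.
    0 < \<eta> \<and> \<eta> < 1 / L_tilde n L P \<and>
    0 < \<omega> \<and> \<omega> \<le> 1 - L_tilde n L P * \<eta> / (1 - L_tilde n L P * \<eta>) \<and>
    m \<ge> 1 \<and>
    (\<forall>x0 \<epsilon>.
       0 < \<epsilon> \<and> \<epsilon> \<le> (objective n f g x0 - objective n f g xstar) / 2 \<longrightarrow>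
       (\<exists>R.
          measure_pmf.expectation
            (asvrg_restarted n f g P \<eta> \<omega> m (restart_length \<eta> \<omega> m \<mu>) x0 R)
            (objective n f g) - objective n f g xstar \<le> \<epsilon> \<and>
          real (oracle_calls n m (restart_length \<eta> \<omega> m \<mu>) R)
            \<le> 100 * ((real n + sqrt (real n * L_tilde n L P / \<mu>)) *
                     ln ((objective n f g x0 - objective n f g xstar) / \<epsilon>))))"
proof -
  interpret composite_problem n f g L \<mu> P xstar
    using assms by unfold_locales
  \<comment> \<open>With \<open>Lt * \<eta> = 1 / 4\<close> the admissible momentum is at most
    \<open>1 - 1 / 3 = 2 / 3\<close>.\<close>
  define \<eta> where "\<eta> = 1 / (4 * Lt)"
  define s where "s = sqrt (real n * Lt / \<mu>)"
  obtain \<omega> where \<omega>: "0 < \<omega>" "\<omega> \<le> 2 / 3"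
    and S: "3 * real n * real (restart_length \<eta> \<omega> n \<mu>) \<le> 24 * (real n + s)"
    using momentum_choice[OF n_ge Lt_pos mu_pos] unfolding \<eta>_def s_def by blast
  have \<eta>: "0 < \<eta>" "\<eta> < 1 / Lt" "Lt * \<eta> = 1 / 4"
    using Lt_pos by (auto simp: \<eta>_def divide_simps)
  have \<omega>_le: "\<omega> \<le> 1 - Lt * \<eta> / (1 - Lt * \<eta>)"
    using \<omega> by (simp add: \<eta>(3))
  interpret asvrg n f g L \<mu> P xstar \<eta> \<omega>
    using \<eta> \<omega> \<omega>_le by unfold_locales
  show ?thesis
  proof (rule exI[of _ \<eta>], rule exI[of _ \<omega>], rule exI[of _ n], intro conjI allI impI)
    fix x0 \<epsilon>
    assume "0 < \<epsilon> \<and> \<epsilon> \<le> (objective n f g x0 - objective n f g xstar) / 2"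
    then have \<epsilon>: "\<epsilon> > 0" "gap x0 / \<epsilon> \<ge> 2"
      by (auto simp: gap_def field_simps)
    then obtain R where R: "gap x0 / \<epsilon> \<le> 2 ^ R" "real R \<le> 3 * ln (gap x0 / \<epsilon>)"
      using halving_rounds by blast
    have "gap x0 / 2 ^ R \<le> \<epsilon>"
      using R(1) \<epsilon>(1) by (simp add: field_simps)
    then have "measure_pmf.expectation
        (asvrg_restarted n f g P \<eta> \<omega> n (restart_length \<eta> \<omega> n \<mu>) x0 R)
        (objective n f g) - objective n f g xstar \<le> \<epsilon>"
      using restarted_objective[OF n_ge] by (rule order.trans[rotated])
    moreover have "real (oracle_calls n n (restart_length \<eta> \<omega> n \<mu>) R)
        \<le> 100 * ((real n + s) * ln (gap x0 / \<epsilon>))"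
    proof -
      \<comment> \<open>The choice \<open>m = n\<close> makes an epoch cost \<open>3 * n\<close>
        evaluations, so the full gradient costs no more than the inner iterations.\<close>
      have "real (oracle_calls n n (restart_length \<eta> \<omega> n \<mu>) R)
          = real R * (3 * real n * real (restart_length \<eta> \<omega> n \<mu>))"
        by (simp add: oracle_calls_def algebra_simps)
      also have "\<dots> \<le> (3 * ln (gap x0 / \<epsilon>)) * (24 * (real n + s))"
        using R(2) S by (rule mult_mono) (use R(2) in auto)
      also have "\<dots> = 72 * ((real n + s) * ln (gap x0 / \<epsilon>))"
        by simp
      also have "\<dots> \<le> 100 * ((real n + s) * ln (gap x0 / \<epsilon>))"
      proof (intro mult_right_mono mult_nonneg_nonneg)
        show "0 \<le> ln (gap x0 / \<epsilon>)"
          using \<epsilon>(2) by (intro ln_ge_zero) linarith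
        show "0 \<le> real n + s"
          using Lt_pos mu_pos by (simp add: s_def)
      qed simp
      finally show ?thesis .
    qed
    ultimately show "\<exists>R. measure_pmf.expectation
        (asvrg_restarted n f g P \<eta> \<omega> n (restart_length \<eta> \<omega> n \<mu>) x0 R)
        (objective n f g) - objective n f g xstar \<le> \<epsilon> \<and>
        real (oracle_calls n n (restart_length \<eta> \<omega> n \<mu>) R)
        \<le> 100 * ((real n + sqrt (real n * Lt / \<mu>)) *
          ln ((objective n f g x0 - objective n f g xstar) / \<epsilon>))"
      unfolding gap_def s_def by blast
  qed (use \<eta> \<omega> \<omega>_le n_ge in auto)
qed

end
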